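(* Let $n\geq 2$ be an integer. Then $$\sum_{\sigma\in B_n}x^{\mathrm{ofmaj}(\sigma)}y^{\mathrm{odes}(\sigma)}z^{\mathrm{oneg}(\sigma)}=\frac{n!}{2^{\lfloor n/2\rfloor}}(1+xz)^{p_{n+1}}\prod_{j=1}^{\lfloor n/2\rfloor}(1+3xz+3yx^{2j}+yzx^{2j+1}),$$ and $$\sum_{\sigma\in B_n}x^{\mathrm{efmaj}(\sigma)}y^{\mathrm{edes}(\sigma)}z^{\mathrm{eneg}(\sigma)}=\frac{n!}{2^{\lfloor (n-1)/2\rfloor}}(1+y)(1+xz)^{p_n}\prod_{j=1}^{\lfloor (n-1)/2\rfloor}(1+3xz+3yx^{2j}+yzx^{2j+1}).$$
   Context: $B_n$ is the hyperoctahedral group: the group of bijections $\sigma$ of $\{-n,\dots,-1,1,\dots,n\}$ with $\sigma(-i)=-\sigma(i)$ for all $i$. For $\sigma\in B_n$ put $\sigma(0)=0$ and let $D(\sigma)=\{i\in\{0,1,\dots,n-1\}:\sigma(i)>\sigma(i+1)\}$ and $\mathrm{Neg}(\sigma)=\{i\in\{1,\dots,n\}:\sigma(i)<0\}$. For a set $J$ of integers, $J_o$ and $J_e$ denote its subsets of odd, respectively even, elements ($0$ is even). Define $\mathrm{odes}(\sigma)=|D(\sigma)_o|$, $\mathrm{edes}(\sigma)=|D(\sigma)_e|$, $\mathrm{omaj}(\sigma)=\sum_{i\in D(\sigma)_o}\frac{i+1}{2}$, $\mathrm{emaj}(\sigma)=\sum_{i\in D(\sigma)_e}\frac{i}{2}$,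 $\mathrm{oneg}(\sigma)=|\mathrm{Neg}(\sigma)_o|$, $\mathrm{eneg}(\sigma)=|\mathrm{Neg}(\sigma)_e|$, $\mathrm{ofmaj}(\sigma)=2\,\mathrm{omaj}(\sigma)+\mathrm{oneg}(\sigma)$, $\mathrm{efmaj}(\sigma)=2\,\mathrm{emaj}(\sigma)+\mathrm{eneg}(\sigma)$. For an integer $k$, $p_k=(1+(-1)^k)/2$. Empty products equal $1$. *)

theory Defs
  imports Complex_Main "HOL-Combinatorics.Permutations"
begin

text \<open>
  A signed permutation is represented by its extension to all of \<^typ>\<open>int\<close> that is the identity
  outside \<open>{-n, \<dots>, -1, 1, \<dots>, n}\<close> (this is what \<open>permutes\<close> requires). In particular
  the convention \<open>\<sigma> 0 = 0\<close> holds automatically.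
\<close>

definition hyperoctahedral :: "nat \<Rightarrow> (int \<Rightarrow> int) set" where
  "hyperoctahedral n =
    {\<sigma>. \<sigma> permutes ({- int n..int n} - {0}) \<and>
         (\<forall>i \<in> {- int n..int n} - {0}. \<sigma> (- i) = - \<sigma> i)}"

definition Des :: "nat \<Rightarrow> (int \<Rightarrow> int) \<Rightarrow> nat set" where
  "Des n \<sigma> = {i \<in> {0..<n}. \<sigma> (int i) > \<sigma> (int (i + 1))}"

definition Neg :: "nat \<Rightarrow> (int \<Rightarrow> int) \<Rightarrow> nat set" where
  "Neg n \<sigma> = {i \<in> {1..n}. \<sigma> (int i) < 0}"

definition odd_part :: "nat set \<Rightarrow> nat set" where
  "odd_part J = {i \<in> J. odd i}"

definition even_part :: "nat set \<Rightarrow> nat set" where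
  "even_part J = {i \<in> J. even i}"

definition odes :: "nat \<Rightarrow> (int \<Rightarrow> int) \<Rightarrow> nat" where
  "odes n \<sigma> = card (odd_part (Des n \<sigma>))"

definition edes :: "nat \<Rightarrow> (int \<Rightarrow> int) \<Rightarrow> nat" where
  "edes n \<sigma> = card (even_part (Des n \<sigma>))"

text \<open>The divisions in the next two definitions and in \<open>parity_exp\<close> are exact.\<close>

definition omaj :: "nat \<Rightarrow> (int \<Rightarrow> int) \<Rightarrow> nat" where
  "omaj n \<sigma> = (\<Sum>i \<in> odd_part (Des n \<sigma>). (i + 1) div 2)"

definition emaj :: "nat \<Rightarrow> (int \<Rightarrow> int) \<Rightarrow> nat" where
  "emaj n \<sigma> = (\<Sum>i \<in> even_part (Des n \<sigma>). i div 2)"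

definition oneg :: "nat \<Rightarrow> (int \<Rightarrow> int) \<Rightarrow> nat" where
  "oneg n \<sigma> = card (odd_part (Neg n \<sigma>))"

definition eneg :: "nat \<Rightarrow> (int \<Rightarrow> int) \<Rightarrow> nat" where
  "eneg n \<sigma> = card (even_part (Neg n \<sigma>))"

definition ofmaj :: "nat \<Rightarrow> (int \<Rightarrow> int) \<Rightarrow> nat" where
  "ofmaj n \<sigma> = 2 * omaj n \<sigma> + oneg n \<sigma>"

definition efmaj :: "nat \<Rightarrow> (int \<Rightarrow> int) \<Rightarrow> nat" where
  "efmaj n \<sigma> = 2 * emaj n \<sigma> + eneg n \<sigma>"

definition parity_exp :: "nat \<Rightarrow> nat" where
  "parity_exp k = nat ((1 + (- 1 :: int) ^ k) div 2)"

end

theory Submission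
  imports Defs
begin

text \<open>
  Fix a parity and cut the positions into blocks \<open>{i, i + 1}\<close>, where \<open>i\<close> runs through the numbers
  of that parity in \<open>{0..n}\<close>. The odd (or even) statistics see \<open>\<sigma>\<close> only through data local to
  these blocks: whether \<open>\<sigma> i < 0\<close>, and whether \<open>i\<close> is a descent. Hence the monomial in
  \<open>x, y, z\<close> factors as a product of local weights, one for each block
  (\<open>odd_statistics\<close>, \<open>even_statistics\<close>).

  The blocks are disjoint and behave like independent random variables. Indeed, composing \<open>\<sigma>\<close> on
  the right with a signed permutation of the positions of one block leaves all other local weights
  unchanged, and right translation is a bijection of the group, so that the weight of this
  block may be replaced by its mean over these translations as soon as this mean does not depend
  on \<open>\<sigma>\<close> (\<open>sum_hyperoctahedral_average\<close>). It does not: for a full block with descent factor \<open>b\<close> and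
  sign factor \<open>a = x * z\<close>, the eight signed arrangements of two values of distinct absolute value
  always contribute \<open>1 + 3 * a + 3 * b + a * b\<close> in total (\<open>sum_pair_weight\<close>). A block \<open>{0, 1}\<close> has mean
  \<open>(1 + y) / 2\<close>, because \<open>\<sigma> 0 = 0\<close> turns its descent into the sign of \<open>\<sigma> 1\<close>, and a block \<open>{n}\<close>,
  which is cut off by the right end, has mean \<open>(1 + x * z) / 2\<close>.

  Thus the generating function is the order \<open>2 ^ n * n!\<close> of the group times the product of the means
  (\<open>sum_prod_block_weight\<close>). A full block occupies two positions and has denominator \<open>8\<close>, so after
  absorbing the factor \<open>2\<close> of each position it leaves \<open>1 / 2\<close>, while the other blocks leave no
  denominator; this accounts for the power of \<open>2\<close> in the result.
\<close>

section \<open>The hyperoctahedral group\<close>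

lemma hyperoctahedral_permutes:
  "\<sigma> \<in> hyperoctahedral n \<Longrightarrow> \<sigma> permutes ({- int n..int n} - {0})"
  by (simp add: hyperoctahedral_def)

lemma hyperoctahedral_uminus:
  assumes "\<sigma> \<in> hyperoctahedral n"
  shows "\<sigma> (- i) = - \<sigma> i"
proof (cases "i \<in> {- int n..int n} - {0}")
  case True
  then show ?thesis using assms by (simp add: hyperoctahedral_def)
next
  case False
  then have "- i \<notin> {- int n..int n} - {0}" by auto
  then show ?thesis
    using False permutes_not_in[OF hyperoctahedral_permutes[OF assms]] by metis
qed

lemma hyperoctahedralI:
  assumes "\<sigma> permutes ({- int n..int n} - {0})" and "\<And>i. \<sigma> (- i) = - \<sigma> i"
  shows "\<sigma> \<in> hyperoctahedral n"
  using assms by (simp add: hyperoctahedral_def)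

lemma hyperoctahedral_eq_iff:
  "\<sigma> \<in> hyperoctahedral n \<Longrightarrow> \<sigma> i = \<sigma> j \<longleftrightarrow> i = j"
  by (meson hyperoctahedral_permutes injD permutes_inj)

lemma hyperoctahedral_eq_uminus_iff:
  "\<sigma> \<in> hyperoctahedral n \<Longrightarrow> \<sigma> i = - \<sigma> j \<longleftrightarrow> i = - j"
  by (metis hyperoctahedral_eq_iff hyperoctahedral_uminus)

lemma hyperoctahedral_zero: "\<sigma> \<in> hyperoctahedral n \<Longrightarrow> \<sigma> 0 = 0"
  using hyperoctahedral_uminus[of \<sigma> n 0] by simp

lemma hyperoctahedral_eq_zero_iff: "\<sigma> \<in> hyperoctahedral n \<Longrightarrow> \<sigma> i = 0 \<longleftrightarrow> i = 0"
  by (metis hyperoctahedral_eq_iff hyperoctahedral_zero)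

lemma finite_hyperoctahedral: "finite (hyperoctahedral n)"
  by (rule finite_subset[OF _ finite_permutations[of "{- int n..int n} - {0}"]])
    (auto simp: hyperoctahedral_def)

lemma id_in_hyperoctahedral: "id \<in> hyperoctahedral n"
  by (simp add: hyperoctahedral_def permutes_id)

lemma comp_in_hyperoctahedral:
  "\<sigma> \<in> hyperoctahedral n \<Longrightarrow> \<tau> \<in> hyperoctahedral n \<Longrightarrow> \<sigma> \<circ> \<tau> \<in> hyperoctahedral n"
  by (rule hyperoctahedralI)
    (auto simp: hyperoctahedral_uminus intro: permutes_compose hyperoctahedral_permutes)

lemma inv_in_hyperoctahedral:
  assumes "\<sigma> \<in> hyperoctahedral n"
  shows "inv \<sigma> \<in> hyperoctahedral n"
proof (rule hyperoctahedralI)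
  note p = hyperoctahedral_permutes[OF assms]
  show "inv \<sigma> permutes ({- int n..int n} - {0})"
    using p by (rule permutes_inv)
  show "inv \<sigma> (- i) = - inv \<sigma> i" for i
    by (metis assms hyperoctahedral_uminus p permutes_inv_eq)
qed

text \<open>Right translation permutes the group. All the averaging below rests on this.\<close>

lemma sum_hyperoctahedral_comp:
  assumes "h \<in> hyperoctahedral n"
  shows "(\<Sum>\<sigma> \<in> hyperoctahedral n. F (\<sigma> \<circ> h)) = (\<Sum>\<sigma> \<in> hyperoctahedral n. F \<sigma>)"
proof (rule sum.reindex_bij_witness[where j = "\<lambda>\<sigma>. \<sigma> \<circ> h" and i = "\<lambda>\<sigma>. \<sigma> \<circ> inv h"])
  note p = hyperoctahedral_permutes[OF assms]
  show "\<sigma> \<circ> h \<circ> inv h = \<sigma>" "\<sigma> \<circ> inv h \<circ> h = \<sigma>" for \<sigma> :: "int \<Rightarrow> int"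
    using permutes_inv_o[OF p] by (simp_all add: comp_assoc)
qed (auto intro: comp_in_hyperoctahedral inv_in_hyperoctahedral assms)

text \<open>
  A signed permutation is determined by its absolute values on \<open>{1..n}\<close>, which form an
  ordinary permutation, and by the set of positions carrying a negative sign.
\<close>

lemma card_hyperoctahedral: "card (hyperoctahedral n) = 2 ^ n * fact n"
proof -
  let ?N = "{1..int n}" and ?S = "{- int n..int n} - {0}"
  \<comment> \<open>the odd extension of \<open>p\<close>, with signs reversed at the positions in \<open>T\<close>; outside \<open>?N\<close>, where
    \<open>p\<close> is the identity, the sign factor makes it the identity as well\<close>
  define E :: "(int \<Rightarrow> int) \<Rightarrow> int set \<Rightarrow> int \<Rightarrow> int" where
    "E p T i = (if \<bar>i\<bar> \<in> T then - (sgn i * p \<bar>i\<bar>) else sgn i * p \<bar>i\<bar>)" for p T i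
  have E_pos: "E p T i = (if i \<in> T then - p i else p i)" if "i \<in> ?N" for p T i
    using that by (simp add: E_def)
  have "bij_betw (\<lambda>(p, T). E p T) ({p. p permutes ?N} \<times> Pow ?N) (hyperoctahedral n)"
    unfolding bij_betw_def
  proof
    have range: "p i \<in> ?N" if "p permutes ?N" "i \<in> ?N" for p i
      using permutes_in_image[OF that(1)] that(2) by blast
    show "inj_on (\<lambda>(p, T). E p T) ({p. p permutes ?N} \<times> Pow ?N)"
    proof (rule inj_onI, clarsimp)
      fix p T q U
      assume p: "p permutes ?N" and q: "q permutes ?N" and T: "T \<subseteq> ?N" and U: "U \<subseteq> ?N"
        and eq: "E p T = E q U"
      have *: "p i = q i \<and> (i \<in> T \<longleftrightarrow> i \<in> U)" if i: "i \<in> ?N" for i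
        using fun_cong[OF eq, of i] range[OF p i] range[OF q i]
        by (auto simp: E_pos[OF i] split: if_splits)
      have "p = q"
        using * permutes_not_in[OF p] permutes_not_in[OF q] by (metis ext)
      then show "p = q \<and> T = U" using * T U by blast
    qed
    show "(\<lambda>(p, T). E p T) ` ({p. p permutes ?N} \<times> Pow ?N) = hyperoctahedral n"
    proof (intro equalityI subsetI)
      fix \<sigma> assume "\<sigma> \<in> (\<lambda>(p, T). E p T) ` ({p. p permutes ?N} \<times> Pow ?N)"
      then obtain p T where p: "p permutes ?N" and T: "T \<subseteq> ?N" and \<sigma>: "\<sigma> = E p T" by auto
      have pabs: "p \<bar>i\<bar> \<in> ?N" if "i \<in> ?S" for i
        by (rule range[OF p]) (use that in auto)
      show "\<sigma> \<in> hyperoctahedral n"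
      proof (rule hyperoctahedralI)
        show "\<sigma> (- i) = - \<sigma> i" for i by (simp add: \<sigma> E_def sgn_minus)
        have inj: "inj_on \<sigma> ?S"
        proof (rule inj_onI)
          fix i j assume i: "i \<in> ?S" and j: "j \<in> ?S" and eq: "\<sigma> i = \<sigma> j"
          have "\<bar>\<sigma> k\<bar> = p \<bar>k\<bar>" if "k \<in> ?S" for k
            using pabs[OF that] that by (auto simp: \<sigma> E_def abs_mult abs_sgn_eq)
          then have "p \<bar>i\<bar> = p \<bar>j\<bar>" using eq i j by metis
          then have ab: "\<bar>i\<bar> = \<bar>j\<bar>" using permutes_inj[OF p] by (meson injD)
          then have "sgn i = sgn j"
            using eq pabs[OF j] by (auto simp: \<sigma> E_def split: if_splits)
          then show "i = j" using ab by (metis sgn_mult_abs)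
        qed
        have sub: "\<sigma> ` ?S \<subseteq> ?S"
        proof
          fix k assume "k \<in> \<sigma> ` ?S"
          then obtain i where i: "i \<in> ?S" "k = \<sigma> i" by blast
          have "sgn i = 1 \<or> sgn i = -1" using i by (auto simp: sgn_if)
          then show "k \<in> ?S" using pabs[OF i(1)] by (auto simp: i(2) \<sigma> E_def)
        qed
        have fin: "finite ?S" by simp
        show "\<sigma> permutes ?S"
        proof (rule bij_imp_permutes)
          show "bij_betw \<sigma> ?S ?S"
            using endo_inj_surj[OF fin sub inj] inj by (simp add: bij_betw_def)
          fix i assume i: "i \<notin> ?S"
          then have "\<bar>i\<bar> \<notin> ?N" by auto
          then have "p \<bar>i\<bar> = \<bar>i\<bar>" "\<bar>i\<bar> \<notin> T" using permutes_not_in[OF p] T by auto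
          then show "\<sigma> i = i" by (simp add: \<sigma> E_def sgn_mult_abs)
        qed
      qed
    next
      fix \<sigma> assume \<sigma>: "\<sigma> \<in> hyperoctahedral n"
      note perm = hyperoctahedral_permutes[OF \<sigma>]
      define p where "p i = (if i \<in> ?N then \<bar>\<sigma> i\<bar> else i)" for i
      define T where "T = {i \<in> ?N. \<sigma> i < 0}"
      have "\<sigma> i \<in> ?S" if "i \<in> ?N" for i
        using permutes_in_image[OF perm, of i] that by auto
      then have sub: "p ` ?N \<subseteq> ?N" by (force simp: p_def)
      have inj: "inj_on p ?N"
        by (rule inj_onI)
          (auto simp: p_def abs_eq_iff hyperoctahedral_eq_iff[OF \<sigma>]
            hyperoctahedral_eq_uminus_iff[OF \<sigma>])
      have p: "p permutes ?N"
        by (rule bij_imp_permutes)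
          (use endo_inj_surj[OF _ sub inj] inj in \<open>auto simp: bij_betw_def p_def\<close>)
      have pos: "E p T i = \<sigma> i" if "i \<in> ?N" for i
        unfolding E_pos[OF that] using that by (simp add: T_def p_def)
      have "E p T i = \<sigma> i" for i
      proof -
        consider "i \<in> ?N" | "- i \<in> ?N" | "i = 0" | "i \<notin> ?S" by fastforce
        then show ?thesis
        proof cases
          case 2
          have "E p T i = - E p T (- i)" by (simp add: E_def sgn_minus)
          also have "\<dots> = \<sigma> i" using pos[OF 2] hyperoctahedral_uminus[OF \<sigma>, of i] by simp
          finally show ?thesis .
        next
          case 4
          then have "\<bar>i\<bar> \<notin> ?N" by auto
          then show ?thesis
            using permutes_not_in[OF perm 4] permutes_not_in[OF p, of "\<bar>i\<bar>"]
            by (auto simp: E_def T_def sgn_mult_abs)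
        next
          case 3
          then show ?thesis by (simp add: E_def hyperoctahedral_zero[OF \<sigma>])
        qed (rule pos)
      qed
      then have "\<sigma> = E p T" by auto
      then show "\<sigma> \<in> (\<lambda>(p, T). E p T) ` ({p. p permutes ?N} \<times> Pow ?N)"
        using p by (intro image_eqI[where x = "(p, T)"]) (auto simp: T_def)
    qed
  qed
  from bij_betw_same_card[OF this] show ?thesis
    by (simp add: card_cartesian_product card_Pow card_permutations[of ?N n]
        mult.commute)
qed

text \<open>Two kinds of group elements suffice to act on a block of one or two positions.\<close>

definition flip_sign :: "int \<Rightarrow> int \<Rightarrow> int" where
  "flip_sign a = transpose a (- a)"

definition swap_positions :: "int \<Rightarrow> int \<Rightarrow> int \<Rightarrow> int" where
  "swap_positions a b = transpose a b \<circ> transpose (- a) (- b)"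

lemma flip_sign_in_hyperoctahedral:
  "1 \<le> a \<Longrightarrow> a \<le> int n \<Longrightarrow> flip_sign a \<in> hyperoctahedral n"
  unfolding flip_sign_def
  by (rule hyperoctahedralI, rule permutes_swap_id) (auto simp: transpose_def)

lemma swap_positions_in_hyperoctahedral:
  "1 \<le> a \<Longrightarrow> a \<le> int n \<Longrightarrow> 1 \<le> b \<Longrightarrow> b \<le> int n \<Longrightarrow> swap_positions a b \<in> hyperoctahedral n"
  unfolding swap_positions_def
  by (rule hyperoctahedralI, rule permutes_compose; (rule permutes_swap_id)?)
    (auto simp: transpose_def)

section \<open>Averaging over independent blocks\<close>

text \<open>
  Averaging the sum of \<open>w * G\<close> over the translates by \<open>hs\<close> leaves \<open>G\<close> alone and replaces \<open>w\<close>
  by its mean value \<open>c\<close>. The translations form a list, not a set, so that nothing needs to be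
  said about which of them coincide.
\<close>

lemma sum_hyperoctahedral_average:
  fixes c :: "'a :: field_char_0"
  assumes hs: "set hs \<subseteq> hyperoctahedral n" "hs \<noteq> []"
    and mean: "\<And>\<sigma>. \<sigma> \<in> hyperoctahedral n \<Longrightarrow>
      (\<Sum>h\<leftarrow>hs. w (\<sigma> \<circ> h)) = of_nat (length hs) * c"
    and inv: "\<And>\<sigma> h. \<sigma> \<in> hyperoctahedral n \<Longrightarrow> h \<in> set hs \<Longrightarrow> G (\<sigma> \<circ> h) = G \<sigma>"
  shows "(\<Sum>\<sigma> \<in> hyperoctahedral n. w \<sigma> * G \<sigma>) = c * (\<Sum>\<sigma> \<in> hyperoctahedral n. G \<sigma>)"
proof -
  let ?B = "hyperoctahedral n"
  have "of_nat (length hs) * (\<Sum>\<sigma>\<in>?B. w \<sigma> * G \<sigma>)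
      = (\<Sum>h\<leftarrow>hs. \<Sum>\<sigma>\<in>?B. w (\<sigma> \<circ> h) * G \<sigma>)"
    using hs(1) inv
  proof (induction hs)
    case (Cons h hs)
    have "(\<Sum>\<sigma>\<in>?B. w (\<sigma> \<circ> h) * G \<sigma>) = (\<Sum>\<sigma>\<in>?B. w (\<sigma> \<circ> h) * G (\<sigma> \<circ> h))"
      by (rule sum.cong) (simp_all only: Cons.prems(2) list.set_intros)
    also have "\<dots> = (\<Sum>\<sigma>\<in>?B. w \<sigma> * G \<sigma>)"
      using Cons.prems(1) by (intro sum_hyperoctahedral_comp[where F = "\<lambda>\<sigma>. w \<sigma> * G \<sigma>"]) auto
    moreover have "of_nat (length hs) * (\<Sum>\<sigma>\<in>?B. w \<sigma> * G \<sigma>)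
        = (\<Sum>h\<leftarrow>hs. \<Sum>\<sigma>\<in>?B. w (\<sigma> \<circ> h) * G \<sigma>)"
    proof (rule Cons.IH)
      show "set hs \<subseteq> ?B" using Cons.prems(1) by simp
      show "G (\<sigma> \<circ> k) = G \<sigma>" if "\<sigma> \<in> ?B" "k \<in> set hs" for \<sigma> k
        by (rule Cons.prems(2)[OF that(1)]) (simp add: that(2))
    qed
    ultimately show ?case by (simp only: list.map sum_list.Cons length_Cons of_nat_Suc
          distrib_right mult_1)
  qed simp
  also have "\<dots> = (\<Sum>\<sigma>\<in>?B. (\<Sum>h\<leftarrow>hs. w (\<sigma> \<circ> h)) * G \<sigma>)"
    by (induction hs) (simp_all add: sum.distrib distrib_right)
  also have "\<dots> = of_nat (length hs) * (c * (\<Sum>\<sigma>\<in>?B. G \<sigma>))"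
    by (simp add: mean sum_distrib_left mult.assoc)
  finally show ?thesis using hs(2) by simp
qed

text \<open>
  Independence of blocks: if the translations that average one weight do not affect the other
  weights, then the weights can be averaged one after the other.
\<close>

lemma sum_hyperoctahedral_prod:
  fixes c :: "'i \<Rightarrow> 'a :: field_char_0"
  assumes "finite A"
    and "\<And>i. i \<in> A \<Longrightarrow> set (hs i) \<subseteq> hyperoctahedral n" "\<And>i. i \<in> A \<Longrightarrow> hs i \<noteq> []"
    and "\<And>i \<sigma>. i \<in> A \<Longrightarrow> \<sigma> \<in> hyperoctahedral n \<Longrightarrow>
      (\<Sum>h\<leftarrow>hs i. w i (\<sigma> \<circ> h)) = of_nat (length (hs i)) * c i"
    and "\<And>i j \<sigma> h. i \<in> A \<Longrightarrow> j \<in> A \<Longrightarrow> i \<noteq> j \<Longrightarrow> \<sigma> \<in> hyperoctahedral n \<Longrightarrow> h \<in> set (hs i) \<Longrightarrow>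
      w j (\<sigma> \<circ> h) = w j \<sigma>"
  shows "(\<Sum>\<sigma> \<in> hyperoctahedral n. \<Prod>i\<in>A. w i \<sigma>) = 2 ^ n * fact n * (\<Prod>i\<in>A. c i)"
  using assms
proof (induction A)
  case empty
  then show ?case by (simp add: card_hyperoctahedral)
next
  case (insert i A)
  have "(\<Sum>\<sigma> \<in> hyperoctahedral n. \<Prod>k\<in>insert i A. w k \<sigma>)
      = (\<Sum>\<sigma> \<in> hyperoctahedral n. w i \<sigma> * (\<Prod>k\<in>A. w k \<sigma>))"
    using insert.hyps by simp
  also have "\<dots> = c i * (\<Sum>\<sigma> \<in> hyperoctahedral n. \<Prod>k\<in>A. w k \<sigma>)"
  proof (rule sum_hyperoctahedral_average[of "hs i"])
    fix \<sigma> h assume *: "\<sigma> \<in> hyperoctahedral n" "h \<in> set (hs i)"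
    show "(\<Prod>k\<in>A. w k (\<sigma> \<circ> h)) = (\<Prod>k\<in>A. w k \<sigma>)"
      by (rule prod.cong[OF refl], rule insert.prems(4)[OF _ _ _ *]) (use insert.hyps in auto)
  qed (rule insert.prems(1-3), simp_all)+
  also have "(\<Sum>\<sigma> \<in> hyperoctahedral n. \<Prod>k\<in>A. w k \<sigma>) = 2 ^ n * fact n * (\<Prod>k\<in>A. c k)"
    by (rule insert.IH; (rule insert.prems)?) simp_all
  finally show ?case using insert.hyps by simp
qed

section \<open>The weight of a block\<close>

text \<open>
  Here \<open>a\<close> marks a negative sign of the first entry and \<open>b\<close> a descent. The sign of the second entry
  is not marked, since the second position has the opposite parity.
\<close>

definition pair_weight :: "'a \<Rightarrow> 'a \<Rightarrow> int \<Rightarrow> int \<Rightarrow> 'a :: comm_semiring_1" where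
  "pair_weight a b p q = (if p < 0 then a else 1) * (if q < p then b else 1)"

text \<open>
  The sum ranges over the eight signed arrangements of two values of distinct absolute value.
  Since all of them occur, it may be assumed that \<open>0 < p < q\<close>. Then exactly \<open>(q, p)\<close>, \<open>(q, -p)\<close>,
  \<open>(p, -q)\<close> are descents with positive first entry, \<open>(-p, -q)\<close> is the only descent with negative
  first entry, \<open>(p, q)\<close> is the only ascent with positive first entry, and the other three are
  ascents with negative first entry.
\<close>

lemma sum_pair_weight:
  assumes "p \<noteq> 0" "q \<noteq> 0" "p \<noteq> q" "p \<noteq> - q"
  shows "pair_weight a b p q + pair_weight a b (- p) q
      + pair_weight a b p (- q) + pair_weight a b (- p) (- q)
      + pair_weight a b q p + pair_weight a b (- q) p
      + pair_weight a b q (- p) + pair_weight a b (- q) (- p)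
      = 1 + 3 * a + 3 * b + (a * b :: 'a :: comm_ring_1)"
proof -
  consider "0 < p" "p < q" | "0 < q" "q < p" | "p < 0" "- p < q" | "0 < q" "q < - p"
    | "0 < p" "p < - q" | "q < 0" "- q < p" | "p < 0" "q < p" | "q < 0" "p < q"
    using assms by linarith
  then show ?thesis by cases (simp_all add: pair_weight_def algebra_simps)
qed

text \<open>
  The exponent \<open>2 * ((i + 1) div 2)\<close> is \<open>i + 1\<close> for odd \<open>i\<close> and \<open>i\<close> for even \<open>i\<close>, which is twice the
  contribution of a descent at \<open>i\<close> to \<^const>\<open>omaj\<close> or \<^const>\<open>emaj\<close>; one formula serves both
  parities. The last position has no successor, so only its sign counts.
\<close>

definition block_weight :: "nat \<Rightarrow> 'a \<Rightarrow> 'a \<Rightarrow> 'a \<Rightarrow> nat \<Rightarrow> (int \<Rightarrow> int) \<Rightarrow> 'a :: comm_semiring_1"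
  where
  "block_weight n x y z i \<sigma> =
    (if i < n then pair_weight (x * z) (y * x ^ (2 * ((i + 1) div 2))) (\<sigma> (int i)) (\<sigma> (int i + 1))
     else if \<sigma> (int i) < 0 then x * z else 1)"

definition block_mean :: "nat \<Rightarrow> 'a \<Rightarrow> 'a \<Rightarrow> 'a \<Rightarrow> nat \<Rightarrow> 'a :: field_char_0" where
  "block_mean n x y z i =
    (if i = 0 then (1 + y) / 2
     else if i = n then (1 + x * z) / 2
     else (1 + 3 * (x * z) + 3 * (y * x ^ (2 * ((i + 1) div 2)))
       + x * z * (y * x ^ (2 * ((i + 1) div 2)))) / 8)"

text \<open>
  The signed permutations of the positions of a block, listed: a copy of \<open>B\<^sub>1\<close> for the blocks
  \<open>{0, 1}\<close> and \<open>{n}\<close>, where only one position can move, and a copy of \<open>B\<^sub>2\<close> otherwise.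
\<close>

definition block_group :: "nat \<Rightarrow> nat \<Rightarrow> (int \<Rightarrow> int) list" where
  "block_group n i =
    (let a = int i; b = int i + 1 in
     if i = 0 then [id, flip_sign b]
     else if i = n then [id, flip_sign a]
     else [id, flip_sign a, flip_sign b, flip_sign a \<circ> flip_sign b,
       swap_positions a b, swap_positions a b \<circ> flip_sign a, swap_positions a b \<circ> flip_sign b,
       swap_positions a b \<circ> flip_sign a \<circ> flip_sign b])"

lemma block_group_subset:
  assumes "1 \<le> n" "i \<le> n"
  shows "set (block_group n i) \<subseteq> hyperoctahedral n"
  using assms
  by (auto simp: block_group_def Let_def
      intro!: comp_in_hyperoctahedral flip_sign_in_hyperoctahedral
        swap_positions_in_hyperoctahedral id_in_hyperoctahedral)

lemma block_group_fixes:
  assumes "h \<in> set (block_group n i)" "k \<noteq> i" "k \<noteq> i + 1"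
  shows "h (int k) = int k"
  using assms
  by (auto simp: block_group_def Let_def flip_sign_def swap_positions_def transpose_def
      split: if_splits)

text \<open>
  The mean over the translates of \<open>\<sigma>\<close> by the group of a block does not depend on \<open>\<sigma>\<close>: translation
  runs through all signed arrangements of the values in the block, and these values are nonzero and
  of distinct absolute value. For \<open>i = 0\<close> the pair is \<open>(0, \<sigma> 1)\<close>, where a negative first entry is
  impossible.
\<close>

lemma block_weight_mean:
  fixes x y z :: "'a :: field_char_0"
  assumes n: "1 \<le> n" "i \<le> n" and \<sigma>: "\<sigma> \<in> hyperoctahedral n"
  shows "(\<Sum>h\<leftarrow>block_group n i. block_weight n x y z i (\<sigma> \<circ> h)) =
    of_nat (length (block_group n i)) * block_mean n x y z i"
proof -
  define a b where "a = int i" and "b = int i + 1"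
  note um = hyperoctahedral_uminus[OF \<sigma>]
  consider "i = 0" | "i = n" "i \<noteq> 0" | "0 < i" "i < n" using n by linarith
  then show ?thesis
  proof cases
    case 1
    have "\<sigma> 1 \<noteq> 0" using hyperoctahedral_eq_zero_iff[OF \<sigma>, of 1] by simp
    then show ?thesis using 1 n um[of 1] hyperoctahedral_zero[OF \<sigma>]
      by (auto simp: block_group_def block_weight_def block_mean_def pair_weight_def
          flip_sign_def transpose_def)
  next
    case 2
    have "\<sigma> (int i) \<noteq> 0" using hyperoctahedral_eq_zero_iff[OF \<sigma>, of "int i"] 2 by simp
    then show ?thesis using 2 um[of "int i"]
      by (auto simp: block_group_def Let_def block_weight_def block_mean_def
          flip_sign_def transpose_def)
  next
    case 3
    let ?w = "pair_weight (x * z) (y * x ^ (2 * ((i + 1) div 2)))"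
    have w: "block_weight n x y z i \<tau> = ?w (\<tau> a) (\<tau> b)" for \<tau>
      using 3 by (simp add: block_weight_def a_def b_def)
    have ab: "0 < a" "0 < b" "a \<noteq> b" using 3 by (auto simp: a_def b_def)
    have grp: "block_group n i =
      [id, flip_sign a, flip_sign b, flip_sign a \<circ> flip_sign b,
       swap_positions a b, swap_positions a b \<circ> flip_sign a, swap_positions a b \<circ> flip_sign b,
       swap_positions a b \<circ> flip_sign a \<circ> flip_sign b]"
      using 3 by (simp add: block_group_def Let_def a_def b_def)
    have flip: "flip_sign a a = - a" "flip_sign b b = - b" "flip_sign a b = b" "flip_sign b a = a"
      "flip_sign a (- b) = - b"
      using ab by (auto simp: flip_sign_def transpose_def)
    have swap: "swap_positions a b a = b" "swap_positions a b b = a"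
      "swap_positions a b (- a) = - b" "swap_positions a b (- b) = - a"
      using ab by (auto simp: swap_positions_def transpose_def)
    have "(\<Sum>h\<leftarrow>block_group n i. block_weight n x y z i (\<sigma> \<circ> h)) =
        ?w (\<sigma> a) (\<sigma> b) + ?w (- \<sigma> a) (\<sigma> b) + ?w (\<sigma> a) (- \<sigma> b) + ?w (- \<sigma> a) (- \<sigma> b)
      + ?w (\<sigma> b) (\<sigma> a) + ?w (- \<sigma> b) (\<sigma> a) + ?w (\<sigma> b) (- \<sigma> a) + ?w (- \<sigma> b) (- \<sigma> a)"
      by (simp add: grp w flip swap um add_ac)
    also have "\<dots> = 8 * block_mean n x y z i"
      using 3 ab
      by (subst sum_pair_weight)
        (auto simp: block_mean_def hyperoctahedral_eq_zero_iff[OF \<sigma>]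
          hyperoctahedral_eq_iff[OF \<sigma>] hyperoctahedral_eq_uminus_iff[OF \<sigma>])
    finally show ?thesis by (simp add: grp)
  qed
qed

text \<open>Starting points of equal parity never differ by \<open>1\<close>, which makes the blocks disjoint.\<close>

lemma sum_prod_block_weight:
  fixes x y z :: "'a :: field_char_0"
  assumes n: "1 \<le> n" and A: "A \<subseteq> {..n}" and par: "\<And>i j. i \<in> A \<Longrightarrow> j \<in> A \<Longrightarrow> even i \<longleftrightarrow> even j"
  shows "(\<Sum>\<sigma> \<in> hyperoctahedral n. \<Prod>i\<in>A. block_weight n x y z i \<sigma>) =
    2 ^ n * fact n * (\<Prod>i\<in>A. block_mean n x y z i)"
proof (rule sum_hyperoctahedral_prod[where hs = "block_group n"])
  show "finite A" using A finite_subset by blast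
  fix i assume i: "i \<in> A"
  then have "i \<le> n" using A by auto
  then show "set (block_group n i) \<subseteq> hyperoctahedral n"
    and "\<And>\<sigma>. \<sigma> \<in> hyperoctahedral n \<Longrightarrow> (\<Sum>h\<leftarrow>block_group n i. block_weight n x y z i (\<sigma> \<circ> h)) =
      of_nat (length (block_group n i)) * block_mean n x y z i"
    using n by (simp_all only: block_group_subset block_weight_mean)
  show "block_group n i \<noteq> []" by (simp add: block_group_def Let_def)
  fix j \<sigma> h assume j: "j \<in> A" "i \<noteq> j" and h: "h \<in> set (block_group n i)"
  have "even i \<longleftrightarrow> even j" using i j par by blast
  then have "j \<noteq> i + 1" "j + 1 \<noteq> i" by auto
  then have "h (int j) = int j" "h (int j + 1) = int j + 1"
    using block_group_fixes[OF h, of j] block_group_fixes[OF h, of "j + 1"] j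
    by (auto simp: add.commute)
  then show "block_weight n x y z j (\<sigma> \<circ> h) = block_weight n x y z j \<sigma>"
    by (simp add: block_weight_def)
qed

section \<open>The statistics as products over blocks\<close>

lemma monomial_eq_prod:
  fixes x y z :: "'a :: comm_semiring_1"
  assumes "finite A"
  shows "x ^ (2 * (\<Sum>i\<in>A \<inter> D. m i) + card (A \<inter> N)) * y ^ card (A \<inter> D) * z ^ card (A \<inter> N) =
    (\<Prod>i\<in>A. (if i \<in> N then x * z else 1) * (if i \<in> D then y * x ^ (2 * m i) else 1))"
proof -
  have "(\<Prod>i\<in>A. (if i \<in> N then x * z else 1) * (if i \<in> D then y * x ^ (2 * m i) else 1)) =
      (\<Prod>i\<in>A \<inter> N. x * z) * (\<Prod>i\<in>A \<inter> D. y * x ^ (2 * m i))"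
    by (subst prod.distrib) (simp only: prod.inter_restrict[OF assms])
  also have "\<dots> = (x * z) ^ card (A \<inter> N) * (y ^ card (A \<inter> D) * x ^ (2 * (\<Sum>i\<in>A \<inter> D. m i)))"
    by (simp add: prod.distrib power_sum sum_distrib_left)
  finally show ?thesis
    by (simp add: power_add power_mult_distrib mult_ac)
qed

text \<open>
  A position \<open>0 \<in> A\<close> does no harm: it is not in \<^const>\<open>Neg\<close>, and its weight has no sign factor
  because \<open>\<sigma> 0 = 0\<close>.
\<close>

lemma prod_block_weight:
  assumes "\<sigma> \<in> hyperoctahedral n" "A \<subseteq> {..n}"
  shows "(\<Prod>i\<in>A. block_weight n x y z i \<sigma>) =
    x ^ (2 * (\<Sum>i\<in>A \<inter> Des n \<sigma>. (i + 1) div 2) + card (A \<inter> Neg n \<sigma>)) *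
    y ^ card (A \<inter> Des n \<sigma>) * z ^ card (A \<inter> Neg n \<sigma>)"
proof -
  have "block_weight n x y z i \<sigma> = (if i \<in> Neg n \<sigma> then x * z else 1) *
      (if i \<in> Des n \<sigma> then y * x ^ (2 * ((i + 1) div 2)) else 1)" if "i \<in> A" for i
  proof -
    have "i \<le> n" using that assms(2) by auto
    then show ?thesis using hyperoctahedral_zero[OF assms(1)]
      by (cases "i = 0") (auto simp: block_weight_def pair_weight_def Neg_def Des_def add.commute)
  qed
  then show ?thesis
    using finite_subset[OF assms(2)] by (subst monomial_eq_prod) (auto intro: prod.cong)
qed

lemma odd_statistics:
  assumes "\<sigma> \<in> hyperoctahedral n"
  shows "x ^ ofmaj n \<sigma> * y ^ odes n \<sigma> * z ^ oneg n \<sigma> =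
    (\<Prod>i\<in>{i. i \<le> n \<and> odd i}. block_weight n x y z i \<sigma>)"
proof -
  have "odd_part (Des n \<sigma>) = {i. i \<le> n \<and> odd i} \<inter> Des n \<sigma>"
    and "odd_part (Neg n \<sigma>) = {i. i \<le> n \<and> odd i} \<inter> Neg n \<sigma>"
    by (auto simp: odd_part_def Des_def Neg_def)
  then show ?thesis
    by (subst prod_block_weight[OF assms])
      (auto simp: ofmaj_def omaj_def odes_def oneg_def)
qed

lemma even_statistics:
  assumes "\<sigma> \<in> hyperoctahedral n"
  shows "x ^ efmaj n \<sigma> * y ^ edes n \<sigma> * z ^ eneg n \<sigma> =
    (\<Prod>i\<in>{i. i \<le> n \<and> even i}. block_weight n x y z i \<sigma>)"
proof -
  have D: "even_part (Des n \<sigma>) = {i. i \<le> n \<and> even i} \<inter> Des n \<sigma>"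
    and N: "even_part (Neg n \<sigma>) = {i. i \<le> n \<and> even i} \<inter> Neg n \<sigma>"
    by (auto simp: even_part_def Des_def Neg_def)
  have "(\<Sum>i\<in>even_part (Des n \<sigma>). i div 2) = (\<Sum>i\<in>even_part (Des n \<sigma>). (i + 1) div 2)"
    by (rule sum.cong) (auto simp: even_part_def)
  then show ?thesis
    by (subst prod_block_weight[OF assms])
      (auto simp: efmaj_def emaj_def edes_def eneg_def D N)
qed

section \<open>The generating functions\<close>

lemma parity_exp_eq: "parity_exp k = (if even k then 1 else 0)"
  by (simp add: parity_exp_def)

text \<open>
  A full block has mean \<open>f / 8\<close> and absorbs \<open>2\<^sup>2\<close> from the order of the group; the remaining
  factors \<open>2\<close> cancel the denominators of the short blocks.
\<close>

lemma two_power_div_eight_power: "2 ^ (2 * k) / 8 ^ k = (1 / 2 ^ k :: 'a :: field_char_0)"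
proof -
  have "(8 :: 'a) ^ k = 2 ^ (2 * k) * 2 ^ k"
    by (simp add: power_mult flip: power_mult_distrib)
  then show ?thesis by simp
qed

lemma prod_block_mean_odd:
  fixes x y z :: "'a :: field_char_0"
  shows "2 ^ n * (\<Prod>i\<in>{i. i \<le> n \<and> odd i}. block_mean n x y z i) =
    (1 + x * z) ^ parity_exp (n + 1) / 2 ^ (n div 2) *
    (\<Prod>j = 1..n div 2. 1 + 3 * x * z + 3 * y * x ^ (2 * j) + y * z * x ^ (2 * j + 1))"
proof -
  let ?m = "block_mean n x y z"
  let ?f = "\<lambda>j. 1 + 3 * x * z + 3 * y * x ^ (2 * j) + y * z * x ^ (2 * j + 1)"
  have "(\<Prod>i\<in>{i. i < n \<and> odd i}. ?m i) = (\<Prod>j = 1..n div 2. ?f j / 8)"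
    by (rule prod.reindex_bij_witness[where i = "\<lambda>j. 2 * j - 1" and j = "\<lambda>i. (i + 1) div 2"])
      (auto simp: block_mean_def mult_ac elim!: oddE)
  then have pairs: "(\<Prod>i\<in>{i. i < n \<and> odd i}. ?m i) = (\<Prod>j = 1..n div 2. ?f j) / 8 ^ (n div 2)"
    by (simp add: prod_dividef)
  show ?thesis
  proof (cases "even n")
    case True
    then obtain k where k: "n = 2 * k" by blast
    have "{i. i \<le> n \<and> odd i} = {i. i < n \<and> odd i}" using True by (auto simp: le_less)
    then have "2 ^ n * (\<Prod>i\<in>{i. i \<le> n \<and> odd i}. ?m i) = 2 ^ (2 * k) / 8 ^ k * (\<Prod>j = 1..k. ?f j)"
      by (simp only: pairs) (simp add: k)
    then show ?thesis
      by (simp only: two_power_div_eight_power) (simp add: k parity_exp_eq)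
  next
    case False
    then obtain k where k: "n = 2 * k + 1" using oddE by blast
    have "{i. i \<le> n \<and> odd i} = insert n {i. i < n \<and> odd i}" using False by (auto simp: le_less)
    then have "(\<Prod>i\<in>{i. i \<le> n \<and> odd i}. ?m i) = (1 + x * z) / 2 * (\<Prod>i\<in>{i. i < n \<and> odd i}. ?m i)"
      using k by (simp add: block_mean_def)
    then have "2 ^ n * (\<Prod>i\<in>{i. i \<le> n \<and> odd i}. ?m i) =
        (1 + x * z) * (2 ^ (2 * k) / 8 ^ k * (\<Prod>j = 1..k. ?f j))"
      by (simp only: pairs) (simp add: k)
    then show ?thesis
      by (simp only: two_power_div_eight_power) (simp add: k parity_exp_eq)
  qed
qed

lemma prod_block_mean_even:
  fixes x y z :: "'a :: field_char_0"
  assumes "1 \<le> n"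
  shows "2 ^ n * (\<Prod>i\<in>{i. i \<le> n \<and> even i}. block_mean n x y z i) =
    (1 + y) * (1 + x * z) ^ parity_exp n / 2 ^ ((n - 1) div 2) *
    (\<Prod>j = 1..(n - 1) div 2. 1 + 3 * x * z + 3 * y * x ^ (2 * j) + y * z * x ^ (2 * j + 1))"
proof -
  let ?m = "block_mean n x y z"
  let ?f = "\<lambda>j. 1 + 3 * x * z + 3 * y * x ^ (2 * j) + y * z * x ^ (2 * j + 1)"
  have "(\<Prod>i\<in>{i. 0 < i \<and> i < n \<and> even i}. ?m i) = (\<Prod>j = 1..(n - 1) div 2. ?f j / 8)"
    by (rule prod.reindex_bij_witness[where i = "\<lambda>j. 2 * j" and j = "\<lambda>i. i div 2"])
      (auto simp: block_mean_def mult_ac elim!: evenE)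
  then have pairs: "(\<Prod>i\<in>{i. 0 < i \<and> i < n \<and> even i}. ?m i) =
      (\<Prod>j = 1..(n - 1) div 2. ?f j) / 8 ^ ((n - 1) div 2)"
    by (simp add: prod_dividef)
  show ?thesis
  proof (cases "even n")
    case True
    then obtain k where k: "n = 2 * k + 2"
      using assms by (intro that[of "n div 2 - 1"]) (auto elim!: evenE)
    have "{i. i \<le> n \<and> even i} = insert 0 (insert n {i. 0 < i \<and> i < n \<and> even i})"
      using True by (auto simp: le_less)
    then have "(\<Prod>i\<in>{i. i \<le> n \<and> even i}. ?m i) =
        (1 + y) / 2 * ((1 + x * z) / 2) * (\<Prod>i\<in>{i. 0 < i \<and> i < n \<and> even i}. ?m i)"
      using k by (simp add: block_mean_def)
    then have "2 ^ n * (\<Prod>i\<in>{i. i \<le> n \<and> even i}. ?m i) =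
        (1 + y) * (1 + x * z) * (2 ^ (2 * k) / 8 ^ k * (\<Prod>j = 1..k. ?f j))"
      by (simp only: pairs) (simp add: k)
    then show ?thesis
      by (simp only: two_power_div_eight_power) (simp add: k parity_exp_eq)
  next
    case False
    then obtain k where k: "n = 2 * k + 1" using oddE by blast
    have "{i. i \<le> n \<and> even i} = insert 0 {i. 0 < i \<and> i < n \<and> even i}"
      using False by (auto simp: le_less)
    then have "(\<Prod>i\<in>{i. i \<le> n \<and> even i}. ?m i) =
        (1 + y) / 2 * (\<Prod>i\<in>{i. 0 < i \<and> i < n \<and> even i}. ?m i)"
      by (simp add: block_mean_def)
    then have "2 ^ n * (\<Prod>i\<in>{i. i \<le> n \<and> even i}. ?m i) =
        (1 + y) * (2 ^ (2 * k) / 8 ^ k * (\<Prod>j = 1..k. ?f j))"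
      by (simp only: pairs) (simp add: k)
    then show ?thesis
      by (simp only: two_power_div_eight_power) (simp add: k parity_exp_eq)
  qed
qed

theorem theorem4p1:
  fixes n :: nat and x y z :: "'a :: field_char_0"
  assumes "n \<ge> 2"
  shows "(\<Sum>\<sigma> \<in> hyperoctahedral n. x ^ ofmaj n \<sigma> * y ^ odes n \<sigma> * z ^ oneg n \<sigma>) =
           fact n / 2 ^ (n div 2) * (1 + x * z) ^ parity_exp (n + 1) *
           (\<Prod>j = 1..n div 2. 1 + 3 * x * z + 3 * y * x ^ (2 * j) + y * z * x ^ (2 * j + 1)) \<and>
         (\<Sum>\<sigma> \<in> hyperoctahedral n. x ^ efmaj n \<sigma> * y ^ edes n \<sigma> * z ^ eneg n \<sigma>) =
           fact n / 2 ^ ((n - 1) div 2) * (1 + y) * (1 + x * z) ^ parity_exp n *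
           (\<Prod>j = 1..(n - 1) div 2. 1 + 3 * x * z + 3 * y * x ^ (2 * j) + y * z * x ^ (2 * j + 1))"
proof
  have n: "1 \<le> n" using assms by simp
  let ?odd = "{i. i \<le> n \<and> odd i}" and ?even = "{i. i \<le> n \<and> even i}"
  have "(\<Sum>\<sigma> \<in> hyperoctahedral n. x ^ ofmaj n \<sigma> * y ^ odes n \<sigma> * z ^ oneg n \<sigma>) =
      (\<Sum>\<sigma> \<in> hyperoctahedral n. \<Prod>i\<in>?odd. block_weight n x y z i \<sigma>)"
    by (rule sum.cong[OF refl]) (rule odd_statistics)
  also have "\<dots> = 2 ^ n * fact n * (\<Prod>i\<in>?odd. block_mean n x y z i)"
    by (rule sum_prod_block_weight[OF n]) auto
  also have "\<dots> = fact n * (2 ^ n * (\<Prod>i\<in>?odd. block_mean n x y z i))"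
    by (simp only: mult_ac)
  finally show "(\<Sum>\<sigma> \<in> hyperoctahedral n. x ^ ofmaj n \<sigma> * y ^ odes n \<sigma> * z ^ oneg n \<sigma>) =
      fact n / 2 ^ (n div 2) * (1 + x * z) ^ parity_exp (n + 1) *
      (\<Prod>j = 1..n div 2. 1 + 3 * x * z + 3 * y * x ^ (2 * j) + y * z * x ^ (2 * j + 1))"
    unfolding prod_block_mean_odd by (simp only: times_divide_eq_left times_divide_eq_right mult.assoc)
  have "(\<Sum>\<sigma> \<in> hyperoctahedral n. x ^ efmaj n \<sigma> * y ^ edes n \<sigma> * z ^ eneg n \<sigma>) =
      (\<Sum>\<sigma> \<in> hyperoctahedral n. \<Prod>i\<in>?even. block_weight n x y z i \<sigma>)"
    by (rule sum.cong[OF refl]) (rule even_statistics)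
  also have "\<dots> = 2 ^ n * fact n * (\<Prod>i\<in>?even. block_mean n x y z i)"
    by (rule sum_prod_block_weight[OF n]) auto
  also have "\<dots> = fact n * (2 ^ n * (\<Prod>i\<in>?even. block_mean n x y z i))"
    by (simp only: mult_ac)
  finally show "(\<Sum>\<sigma> \<in> hyperoctahedral n. x ^ efmaj n \<sigma> * y ^ edes n \<sigma> * z ^ eneg n \<sigma>) =
      fact n / 2 ^ ((n - 1) div 2) * (1 + y) * (1 + x * z) ^ parity_exp n *
      (\<Prod>j = 1..(n - 1) div 2. 1 + 3 * x * z + 3 * y * x ^ (2 * j) + y * z * x ^ (2 * j + 1))"
    unfolding prod_block_mean_even[OF n]
    by (simp only: times_divide_eq_left times_divide_eq_right mult.assoc)
qed

end
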